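(* Let $L$ be a fixed constant. There exists $C>0$ such that, for any $k\in[n-1]$ and any $u\in\{0,1,\dots,\min(k-1,n-k-1)\}$, if $\rho\in\Theta(k,u,C)$, then $$\Pr\left(d_H(\widetilde{\mathcal S}_k,\mathcal S_k)>2u\right)=O(n^{-5}).$$ In particular, when $u=0$, exact recovery $\widetilde{\mathcal S}_k=\mathcal S_k$ holds with probability $1-O(n^{-5})$ provided that $$\tau_{(k)}-\tau_{(k+1)}\ge C\left(\sqrt{\frac{n\log n}{m}}+\frac{n\log n}{m\varepsilon}\right).$$
   Context: Model. There are $n$ items indexed by $[n]$ and $m$ users. Each user $s\in[m]$ makes $L$ comparisons: in each draw $l\in[L]$ the user selects an unordered pair $\{i,j\}\subset[n]$ uniformly at random (with replacement across draws) and reports $Y^{(s,l)}_{ij}=+1$ if $i$ is preferred and $-1$ if $j$ is preferred, with $Y^{(s,l)}_{ji}=-Y^{(s,l)}_{ij}$ and $Y^{(s,l)}_{ij}=0$ for pairs not drawn; $\Pr(i\text{ preferred})=\rho_{ij}$. All comparisons are independent across users and draws. Here $\rho=(\rho_{ij})\in[0,1]^{n\times n}$ satisfies $\rho_{ij}+\rho_{ji}=1$, $\rho_{ii}=1/2$. Let $\tau_i=\frac1n\sum_{j=1}^n\rho_{ij}$, let $\tau_{(1)}\ge\dots\ge\tau_{(n)}$ be the ordered values, and let $\mathcal S_k$ be the set of the $k$ indices with the largest $\tau_i$ (ties broken by an arbitrary fixed rule). $d_H$ is the Hamming distance between sets (cardinality of the symmetric difference). For $\varepsilon>0$, $$\Theta(k,u,c)=\left\{\rho\in[0,1]^{n\times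 n}:\rho_{ij}+\rho_{ji}=1,\ \tau_{(k-u)}-\tau_{(k+u+1)}\ge c\left(\sqrt{\frac{n\log n}{m}}+\frac{n\log n}{m\varepsilon}\right)\right\}.$$ Estimator. $N_i=\sum_{j\ne i}\sum_{s=1}^m\sum_{l=1}^L\mathbf 1(Y^{(s,l)}_{ij}=+1)$ is the total number of wins of item $i$; $W_1,\dots,W_n$ are i.i.d. Laplace with scale $L/\varepsilon$, independent of the data; $\widetilde N_i=N_i+W_i$; and $\widetilde{\mathcal S}_k$ is the set of indices of the top $k$ values among $\{\widetilde N_i\}_{i\in[n]}$. *)

theory Defs
  imports "HOL-Probability.Probability"
begin

text \<open>Items are \<open>{1..n}\<close>, users \<open>{1..m}\<close>, draws \<open>{1..L}\<close>.  Matrices and score vectors are functions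
  on \<open>nat\<close>; only their values at indices in \<open>{1..n}\<close> are ever used.\<close>

text \<open>Taking \<open>i = j\<close> below gives \<open>\<rho> i i = 1/2\<close>.\<close>

definition pref_matrices :: "nat \<Rightarrow> (nat \<Rightarrow> nat \<Rightarrow> real) set" where
  "pref_matrices n = {\<rho>. \<forall>i\<in>{1..n}. \<forall>j\<in>{1..n}. 0 \<le> \<rho> i j \<and> \<rho> i j \<le> 1 \<and> \<rho> i j + \<rho> j i = 1}"

definition tau :: "nat \<Rightarrow> (nat \<Rightarrow> nat \<Rightarrow> real) \<Rightarrow> nat \<Rightarrow> real" where
  "tau n \<rho> i = (1 / real n) * (\<Sum>j=1..n. \<rho> i j)"

text \<open>The \<open>r\<close>-th largest (with multiplicity) of \<open>x 1, \<dots>, x n\<close>; meaningful for \<open>1 \<le> r \<le> n\<close>.\<close>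

definition ordered_value :: "nat \<Rightarrow> (nat \<Rightarrow> real) \<Rightarrow> nat \<Rightarrow> real" where
  "ordered_value n x r = rev (sort (map x [1..<Suc n])) ! (r - 1)"

text \<open>The indices of the \<open>k\<close> largest values.  The tie-breaking rule is a priority function \<open>\<pi>\<close>,
  required to be injective on \<open>{1..n}\<close> wherever this is used: among equal values, the index with
  the smaller priority comes first.\<close>

definition top_set :: "(nat \<Rightarrow> nat) \<Rightarrow> nat \<Rightarrow> nat \<Rightarrow> (nat \<Rightarrow> real) \<Rightarrow> nat set" where
  "top_set \<pi> n k x =
     {i \<in> {1..n}. card {j \<in> {1..n}. x j > x i \<or> (x j = x i \<and> \<pi> j < \<pi> i)} < k}"

definition hamming_dist :: "nat set \<Rightarrow> nat set \<Rightarrow> nat" where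
  "hamming_dist A B = card ((A - B) \<union> (B - A))"

definition separation :: "nat \<Rightarrow> nat \<Rightarrow> real \<Rightarrow> real" where
  "separation n m \<epsilon> =
     sqrt (real n * ln (real n) / real m) + real n * ln (real n) / (real m * \<epsilon>)"

definition Theta :: "nat \<Rightarrow> nat \<Rightarrow> real \<Rightarrow> nat \<Rightarrow> nat \<Rightarrow> real \<Rightarrow> (nat \<Rightarrow> nat \<Rightarrow> real) set" where
  "Theta n m \<epsilon> k u c =
     {\<rho> \<in> pref_matrices n.
        ordered_value n (tau n \<rho>) (k - u) - ordered_value n (tau n \<rho>) (k + u + 1)
          \<ge> c * separation n m \<epsilon>}"

text \<open>The outcome of a single draw is the whole array \<open>i j \<mapsto> Y\<^sub>i\<^sub>j\<close> of that draw.\<close>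

definition report :: "nat \<Rightarrow> nat \<Rightarrow> nat \<Rightarrow> nat \<Rightarrow> int" where
  "report w l = (\<lambda>i j. if i = w \<and> j = l then 1 else if i = l \<and> j = w then - 1 else 0)"

definition comparison_pmf :: "nat \<Rightarrow> (nat \<Rightarrow> nat \<Rightarrow> real) \<Rightarrow> (nat \<Rightarrow> nat \<Rightarrow> int) pmf" where
  "comparison_pmf n \<rho> =
     bind_pmf (pmf_of_set {e. e \<subseteq> {1..n} \<and> card e = 2}) (\<lambda>e.
     map_pmf (\<lambda>b. if b then report (Min e) (Max e) else report (Max e) (Min e))
       (bernoulli_pmf (\<rho> (Min e) (Max e))))"

definition laplace :: "real \<Rightarrow> real measure" where
  "laplace b = density lborel (\<lambda>x. ennreal (exp (- \<bar>x\<bar> / b) / (2 * b)))"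

text \<open>A sample point is a pair \<open>(Y, W)\<close>: \<open>Y (s, l)\<close> is the outcome of draw \<open>l\<close> of user \<open>s\<close>, and
  \<open>W i\<close> is the noise of item \<open>i\<close>.\<close>

type_synonym sample = "(nat \<times> nat \<Rightarrow> nat \<Rightarrow> nat \<Rightarrow> int) \<times> (nat \<Rightarrow> real)"

definition ranking_space ::
    "nat \<Rightarrow> nat \<Rightarrow> nat \<Rightarrow> real \<Rightarrow> (nat \<Rightarrow> nat \<Rightarrow> real) \<Rightarrow> sample measure" where
  "ranking_space n m L \<epsilon> \<rho> =
     (\<Pi>\<^sub>M sl\<in>{1..m} \<times> {1..L}. measure_pmf (comparison_pmf n \<rho>))
       \<Otimes>\<^sub>M (\<Pi>\<^sub>M i\<in>{1..n}. laplace (real L / \<epsilon>))"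

definition wins :: "nat \<Rightarrow> nat \<Rightarrow> nat \<Rightarrow> sample \<Rightarrow> nat \<Rightarrow> nat" where
  "wins n m L \<omega> i =
     (\<Sum>j\<in>{1..n} - {i}. \<Sum>s=1..m. \<Sum>l=1..L. if fst \<omega> (s, l) i j = 1 then 1 else 0)"

definition noisy_wins :: "nat \<Rightarrow> nat \<Rightarrow> nat \<Rightarrow> sample \<Rightarrow> nat \<Rightarrow> real" where
  "noisy_wins n m L \<omega> i = real (wins n m L \<omega> i) + snd \<omega> i"

definition private_top_set ::
    "(nat \<Rightarrow> nat) \<Rightarrow> nat \<Rightarrow> nat \<Rightarrow> nat \<Rightarrow> nat \<Rightarrow> sample \<Rightarrow> nat set" where
  "private_top_set \<pi> n m L k \<omega> = top_set \<pi> n k (noisy_wins n m L \<omega>)"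

end

theory Submission
  imports Defs
begin

text \<open>A win count \<open>N\<^sub>i\<close> is binomial with \<open>mL\<close> trials and a success probability \<open>q\<^sub>i \<le> 2/n\<close> that is affine in
  \<open>\<tau>\<^sub>i\<close> with slope \<open>2/(n - 1)\<close>.  A Chernoff bound in its Gaussian range and the Laplace tail show that, off an
  event of probability \<open>3n\<^sup>-\<^sup>5\<close>, all noisy counts are within \<open>O(\<surd>(m ln n / n) + ln n / \<epsilon>)\<close> of their means.
  The gap in \<open>\<tau>\<close> is large enough for every index among the top \<open>k - u\<close> then to beat every index outside
  the top \<open>k + u\<close>.\<close>

subsection \<open>Top sets and order statistics\<close>

text \<open>A gap \<Delta> in \<open>tau\<close> shifts the mean of a count by about 2mL\<Delta>/n,
  so for fixed L a gap of order sqrt(n ln n / m) is visible only if counts fluctuate by order sqrt(m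
  ln n / n). Hoeffding's inequality for mL bounded summands allows sqrt(m ln n), too wide by a
  factor sqrt n. The rarity of a win has to enter through the moment generating function, at the
  price of a bounded range of deviations. Nothing is asymptotic: the constants 7 and 3 serve every n
  \<ge> 2 and every L \<ge> 1. The failure exponent per item is 6, one more than wanted, because the
  union bound runs over n items.\<close>

definition score_rank :: "(nat \<Rightarrow> nat) \<Rightarrow> nat \<Rightarrow> (nat \<Rightarrow> real) \<Rightarrow> nat \<Rightarrow> nat" where
  "score_rank \<pi> n x i = card {j \<in> {1..n}. x j > x i \<or> (x j = x i \<and> \<pi> j < \<pi> i)}"

lemma top_set_conv_score_rank: "top_set \<pi> n k x = {i \<in> {1..n}. score_rank \<pi> n x i < k}"
  by (simp add: top_set_def score_rank_def)

lemma top_set_subset: "top_set \<pi> n k x \<subseteq> {1..n}"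
  by (auto simp: top_set_def)

lemma finite_top_set [simp]: "finite (top_set \<pi> n k x)"
  using top_set_subset finite_atLeastAtMost by (rule finite_subset)

lemma top_set_mono: "k \<le> k' \<Longrightarrow> top_set \<pi> n k x \<subseteq> top_set \<pi> n k' x"
  by (auto simp: top_set_def)

lemma score_rank_less_if_above:
  assumes "i \<in> {1..n}" "x i > x j \<or> (x i = x j \<and> \<pi> i < \<pi> j)"
  shows "score_rank \<pi> n x i < score_rank \<pi> n x j"
  unfolding score_rank_def by (rule psubset_card_mono) (use assms in auto)

text \<open>Since \<open>\<pi>\<close> is injective, distinct indices are always comparable by score
  and then priority, and the rank strictly increases down this order. No index precedes itself, so
  ranks stay below n, and counting gives surjectivity. Surjectivity is what gives a top set exactly
  k elements even under ties.\<close>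

lemma score_rank_bij_betw:
  assumes "inj_on \<pi> {1..n}"
  shows "bij_betw (score_rank \<pi> n x) {1..n} {..<n}"
proof -
  have inj: "inj_on (score_rank \<pi> n x) {1..n}"
  proof (rule inj_onI, rule ccontr)
    fix i j assume *: "i \<in> {1..n}" "j \<in> {1..n}" "score_rank \<pi> n x i = score_rank \<pi> n x j" "i \<noteq> j"
    then have "\<pi> i \<noteq> \<pi> j"
      using assms by (auto dest: inj_onD)
    then consider "x i > x j \<or> (x i = x j \<and> \<pi> i < \<pi> j)" | "x j > x i \<or> (x j = x i \<and> \<pi> j < \<pi> i)"
      by linarith
    then show False
      using score_rank_less_if_above[of i n x j \<pi>] score_rank_less_if_above[of j n x i \<pi>] * by cases auto
  qed
  have "score_rank \<pi> n x i < n" if "i \<in> {1..n}" for i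
  proof -
    have "i \<notin> {j \<in> {1..n}. x j > x i \<or> (x j = x i \<and> \<pi> j < \<pi> i)}"
      by simp
    then have "{j \<in> {1..n}. x j > x i \<or> (x j = x i \<and> \<pi> j < \<pi> i)} \<subset> {1..n}"
      using that by blast
    then have "score_rank \<pi> n x i < card {1..n}"
      unfolding score_rank_def by (rule psubset_card_mono[rotated]) simp
    then show ?thesis by simp
  qed
  then have "score_rank \<pi> n x ` {1..n} \<subseteq> {..<n}" by auto
  moreover have "card (score_rank \<pi> n x ` {1..n}) = card {..<n}"
    using inj by (simp add: card_image)
  ultimately have "score_rank \<pi> n x ` {1..n} = {..<n}"
    by (intro card_subset_eq) auto
  with inj show ?thesis by (simp add: bij_betw_def)
qed

lemma card_top_set:
  assumes "inj_on \<pi> {1..n}" "k \<le> n"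
  shows "card (top_set \<pi> n k x) = k"
proof -
  have "bij_betw (score_rank \<pi> n x) (top_set \<pi> n k x) {..<k}"
  proof (rule bij_betw_subset[OF score_rank_bij_betw[OF assms(1)] top_set_subset])
    have "{..<k} \<subseteq> score_rank \<pi> n x ` {1..n}"
      using score_rank_bij_betw[OF assms(1), of x] assms(2) by (auto simp: bij_betw_def)
    then show "score_rank \<pi> n x ` top_set \<pi> n k x = {..<k}"
      unfolding top_set_conv_score_rank by blast
  qed
  then show ?thesis by (auto dest: bij_betw_same_card)
qed

section \<open>Order statistics and their relation to top sets\<close>

text \<open>Sorting only permutes the values. This moves counting questions about
  \<open>ordered_value\<close> to initial segments of a decreasing list, with positions counted from
  0.\<close>

lemma card_ordered_list:
  fixes x :: "nat \<Rightarrow> real"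
  shows "card {i \<in> {1..n}. P (x i)} = card {r. r < n \<and> P (rev (sort (map x [1..<Suc n])) ! r)}"
proof -
  let ?xs = "map x [1..<Suc n]"
  have "card {i \<in> {1..n}. P (x i)} = length (filter P ?xs)"
  proof -
    have "length (filter P ?xs) = length (filter (P \<circ> x) [1..<Suc n])"
      by (simp add: filter_map del: upt_Suc)
    also have "\<dots> = card (set (filter (P \<circ> x) [1..<Suc n]))"
      by (rule distinct_card[symmetric]) (simp del: upt_Suc)
    also have "set (filter (P \<circ> x) [1..<Suc n]) = {i \<in> {1..n}. P (x i)}"
      by (auto simp del: upt_Suc)
    finally show ?thesis ..
  qed
  also have "\<dots> = length (filter P (rev (sort ?xs)))"
    by (metis length_rev rev_filter mset_filter mset_sort size_mset)
  also have "\<dots> = card {r. r < n \<and> P (rev (sort ?xs) ! r)}"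
    by (simp add: length_filter_conv_card del: upt_Suc)
  finally show ?thesis .
qed

lemma ordered_list_antimono:
  assumes "r \<le> s" "s < n"
  shows "rev (sort (map x [1..<Suc n])) ! s \<le> (rev (sort (map x [1..<Suc n])) ! r :: real)"
  using assms by (simp add: rev_nth sorted_nth_mono del: upt_Suc)

lemma card_ge_ordered_value:
  assumes "1 \<le> r" "r \<le> n"
  shows "r \<le> card {i \<in> {1..n}. ordered_value n x r \<le> x i}"
proof -
  have "{..<r} \<subseteq> {s. s < n \<and> ordered_value n x r \<le> rev (sort (map x [1..<Suc n])) ! s}"
    using assms ordered_list_antimono[of _ "r - 1" n x] by (auto simp: ordered_value_def simp del: upt_Suc)
  then have "card {..<r} \<le> card {s. s < n \<and> ordered_value n x r \<le> rev (sort (map x [1..<Suc n])) ! s}"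
    by (rule card_mono[rotated]) auto
  then show ?thesis using card_ordered_list[of n "\<lambda>y. ordered_value n x r \<le> y" x] by simp
qed

lemma card_greater_ordered_value:
  assumes "1 \<le> r" "r \<le> n"
  shows "card {i \<in> {1..n}. ordered_value n x r < x i} < r"
proof -
  \<comment> \<open>A strictly larger value must sit strictly before position r - 1, which leaves at
    most r - 1 positions.\<close>
  have "{s. s < n \<and> ordered_value n x r < rev (sort (map x [1..<Suc n])) ! s} \<subseteq> {..<r - 1}"
    using ordered_list_antimono[of "r - 1" _ n x]
    by (force simp: ordered_value_def not_less[symmetric] simp del: upt_Suc)
  then have "card {s. s < n \<and> ordered_value n x r < rev (sort (map x [1..<Suc n])) ! s} \<le> card {..<r - 1}"
    by (rule card_mono[rotated]) auto
  then show ?thesis using card_ordered_list[of n "\<lambda>y. ordered_value n x r < y" x] assms by simp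
qed

lemma ordered_value_in_image:
  assumes "1 \<le> r" "r \<le> n"
  shows "ordered_value n x r \<in> x ` {1..n}"
proof -
  have "ordered_value n x r \<in> set (rev (sort (map x [1..<Suc n])))"
    unfolding ordered_value_def using assms by (intro nth_mem) (simp del: upt_Suc)
  then show ?thesis by (auto simp del: upt_Suc)
qed

text \<open>Otherwise the indices whose value reaches \<open>ordered_value n x r\<close>, of which
  there are at least r, would all precede i and give it rank at least r.\<close>

lemma top_set_ge_ordered_value:
  assumes "i \<in> top_set \<pi> n r x" "1 \<le> r" "r \<le> n"
  shows "ordered_value n x r \<le> x i"
proof (rule ccontr)
  assume "\<not> ?thesis"
  then have "{j \<in> {1..n}. ordered_value n x r \<le> x j} \<subseteq> {j \<in> {1..n}. x j > x i \<or> (x j = x i \<and> \<pi> j < \<pi> i)}"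
    by auto
  then have "card {j \<in> {1..n}. ordered_value n x r \<le> x j} \<le> score_rank \<pi> n x i"
    unfolding score_rank_def by (rule card_mono[rotated]) auto
  with card_ge_ordered_value[OF assms(2,3), of x] assms(1) show False
    by (simp add: top_set_conv_score_rank)
qed

lemma not_top_set_le_ordered_value:
  assumes "i \<in> {1..n} - top_set \<pi> n r x" "r < n"
  shows "x i \<le> ordered_value n x (Suc r)"
proof (rule ccontr)
  assume "\<not> ?thesis"
  with assms(1) have "ordered_value n x (Suc r) < x i" "i \<in> {1..n}" by auto
  moreover have "i \<notin> {j \<in> {1..n}. x j > x i \<or> (x j = x i \<and> \<pi> j < \<pi> i)}" by simp
  \<comment> \<open>The inclusion is proper because i itself lies in the right-hand set only. That
    set has at most r elements, so properness is what pushes the rank of i below r.\<close>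
  ultimately have "{j \<in> {1..n}. x j > x i \<or> (x j = x i \<and> \<pi> j < \<pi> i)} \<subset> {j \<in> {1..n}. ordered_value n x (Suc r) < x j}"
    by (intro psubsetI subsetI) (force, blast)
  then have "score_rank \<pi> n x i < card {j \<in> {1..n}. ordered_value n x (Suc r) < x j}"
    unfolding score_rank_def by (rule psubset_card_mono[rotated]) auto
  with card_greater_ordered_value[of "Suc r" n x] assms(2) have "score_rank \<pi> n x i < r"
    by simp
  with assms(1) show False
    by (auto simp: top_set_conv_score_rank)
qed

section \<open>Hamming distance between top sets\<close>

text \<open>Sets of equal size have differences of equal size, so a bound on either difference
  suffices. Both forms are kept because sometimes the surplus indices and sometimes the missing ones
  are easy to count.\<close>

lemma hamming_dist_eq_card:
  assumes "finite A" "finite B" "card A = card B"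
  shows "hamming_dist A B = 2 * card (A - B)" "hamming_dist A B = 2 * card (B - A)"
proof -
  have "card (A - B) = card (B - A)"
    using assms card_Diff_subset_Int[of A B] card_Diff_subset_Int[of B A] by (simp add: Int_commute)
  moreover have "hamming_dist A B = card (A - B) + card (B - A)"
    unfolding hamming_dist_def using assms by (intro card_Un_disjoint) auto
  ultimately show "hamming_dist A B = 2 * card (A - B)" "hamming_dist A B = 2 * card (B - A)"
    by simp_all
qed

lemma hamming_dist_eq_0_iff:
  assumes "finite A" "finite B"
  shows "hamming_dist A B = 0 \<longleftrightarrow> A = B"
  using assms by (auto simp: hamming_dist_def)

text \<open>If the top set of \<open>y\<close> contains an index outside the top \<open>k + u\<close> of \<open>x\<close>, it must contain the
  whole top \<open>k - u\<close> of \<open>x\<close>; in either case at most \<open>u\<close> indices are exchanged.\<close>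

lemma hamming_dist_top_set_le:
  assumes inj: "inj_on \<pi> {1..n}" and u: "u \<le> k" "k + u \<le> n"
    and sep: "\<And>h l. h \<in> top_set \<pi> n (k - u) x \<Longrightarrow> l \<in> {1..n} - top_set \<pi> n (k + u) x \<Longrightarrow> y l < y h"
  shows "hamming_dist (top_set \<pi> n k y) (top_set \<pi> n k x) \<le> 2 * u"
proof -
  let ?A = "top_set \<pi> n k y" and ?B = "top_set \<pi> n k x"
  have cards: "card ?A = card ?B"
    using card_top_set[OF inj] u by simp
  show ?thesis
  proof (cases "?A \<subseteq> top_set \<pi> n (k + u) x")
    case True
    then have "?A - ?B \<subseteq> top_set \<pi> n (k + u) x - ?B" by auto
    then have "card (?A - ?B) \<le> card (top_set \<pi> n (k + u) x - ?B)"
      by (intro card_mono) auto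
    also have "\<dots> = card (top_set \<pi> n (k + u) x) - card ?B"
      by (intro card_Diff_subset top_set_mono) auto
    also have "\<dots> = u" using card_top_set[OF inj] u by simp
    finally show ?thesis using hamming_dist_eq_card(1)[OF _ _ cards] by simp
  next
    case False
    then obtain l where l: "l \<in> ?A" "l \<in> {1..n} - top_set \<pi> n (k + u) x"
      using top_set_subset by blast
    have "top_set \<pi> n (k - u) x \<subseteq> ?A"
    proof
      fix h assume h: "h \<in> top_set \<pi> n (k - u) x"
      then have "h \<in> {1..n}" using top_set_subset by blast
      with sep[OF h l(2)] have "score_rank \<pi> n y h < score_rank \<pi> n y l"
        by (intro score_rank_less_if_above) auto
      with l(1) \<open>h \<in> {1..n}\<close> show "h \<in> ?A" by (simp add: top_set_conv_score_rank)
    qed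
    then have "?B - ?A \<subseteq> ?B - top_set \<pi> n (k - u) x" by auto
    then have "card (?B - ?A) \<le> card (?B - top_set \<pi> n (k - u) x)"
      by (intro card_mono) auto
    also have "\<dots> = card ?B - card (top_set \<pi> n (k - u) x)"
      by (intro card_Diff_subset top_set_mono) auto
    also have "\<dots> = u" using card_top_set[OF inj] u by simp
    finally show ?thesis using hamming_dist_eq_card(2)[OF _ _ cards] by simp
  qed
qed

subsection \<open>Concentration of Laplace noise and win counts\<close>

text \<open>The absolute value of a Laplace variable is exponential with rate 1/b, and a symmetric
  event depends only on the absolute value. Total mass and tails thus come from the exponential
  distribution.\<close>

lemma emeasure_laplace_symmetric:
  assumes b: "0 < b" and A[measurable]: "A \<in> sets borel" and sym: "\<And>x. - x \<in> A \<longleftrightarrow> x \<in> A"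
  shows "emeasure (laplace b) A = emeasure (density lborel (exponential_density (1 / b))) A"
proof -
  define e where "e x = ennreal (exponential_density (1 / b) x / 2) * indicator A x" for x
  have [measurable]: "e \<in> borel_measurable borel" unfolding e_def by measurable
  have "emeasure (laplace b) A = (\<integral>\<^sup>+x. ennreal (exp (- \<bar>x\<bar> / b) / (2 * b)) * indicator A x \<partial>lborel)"
    by (simp add: laplace_def emeasure_density)
  also have "\<dots> = (\<integral>\<^sup>+x. e x + e (- x) \<partial>lborel)"
  proof (rule nn_integral_cong_AE)
    \<comment> \<open>For x \<noteq> 0 only one of x and -x lies where the exponential density is
      positive, so at most one term on the right is nonzero. At x = 0 both terms count and the sum
      can be twice too large, so this null point is discarded.\<close>
    show "AE x in lborel. ennreal (exp (- \<bar>x\<bar> / b) / (2 * b)) * indicator A x = e x + e (- x)"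
      using AE_lborel_singleton[of 0]
    proof eventually_elim
      case (elim x)
      then show ?case
        using b sym[of x] by (auto simp: e_def exponential_density_def indicator_def field_simps)
    qed
  qed
  also have "\<dots> = (\<integral>\<^sup>+x. e x \<partial>lborel) + (\<integral>\<^sup>+x. e (- x) \<partial>lborel)"
    by (rule nn_integral_add) auto
  also have "(\<integral>\<^sup>+x. e (- x) \<partial>lborel) = (\<integral>\<^sup>+x. e x \<partial>lborel)"
    by (subst (2) nn_integral_real_affine[where c = "-1" and t = 0]) auto
  also have "(\<integral>\<^sup>+x. e x \<partial>lborel) + (\<integral>\<^sup>+x. e x \<partial>lborel) = (\<integral>\<^sup>+x. e x + e x \<partial>lborel)"
    by (rule nn_integral_add[symmetric]) auto
  also have "\<dots> = (\<integral>\<^sup>+x. ennreal (exponential_density (1 / b) x) * indicator A x \<partial>lborel)"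
    using b by (intro nn_integral_cong)
      (auto simp: e_def indicator_def simp flip: ennreal_plus)
  also have "\<dots> = emeasure (density lborel (exponential_density (1 / b))) A"
    by (simp add: emeasure_density)
  finally show ?thesis .
qed

lemma sets_laplace [measurable_cong, simp]: "sets (laplace b) = sets borel"
  by (simp add: laplace_def)

lemma space_laplace [simp]: "space (laplace b) = UNIV"
  by (simp add: laplace_def)

lemma prob_space_laplace:
  assumes "0 < b"
  shows "prob_space (laplace b)"
proof
  interpret E: prob_space "density lborel (exponential_density (1 / b))"
    using assms by (intro prob_space_exponential_density) simp
  show "emeasure (laplace b) (space (laplace b)) = 1"
    using emeasure_laplace_symmetric[OF assms, of UNIV] E.emeasure_space_1 by simp
qed

lemma laplace_tail:
  assumes b: "0 < b" and t: "0 \<le> t"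
  shows "measure (laplace b) {x. t < \<bar>x\<bar>} = exp (- t / b)"
proof -
  let ?E = "density lborel (exponential_density (1 / b))"
  interpret E: prob_space ?E
    using b by (intro prob_space_exponential_density) simp
  have "emeasure (laplace b) {x. t < \<bar>x\<bar>} = emeasure ?E {x. t < \<bar>x\<bar>}"
    by (rule emeasure_laplace_symmetric[OF b]) auto
  \<comment> \<open>The exponential density vanishes on the negative axis, so the left half of the
    event carries no mass.\<close>
  also have "\<dots> = emeasure ?E {t<..}"
    using t by (auto simp: emeasure_density exponential_density_def indicator_def intro!: nn_integral_cong)
  finally have "measure (laplace b) {x. t < \<bar>x\<bar>} = measure ?E {x \<in> space ?E. t < x}"
    by (simp add: measure_def greaterThan_def)
  also have "distributed ?E lborel (\<lambda>x. x) (exponential_density (1 / b))"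
    using b by (auto simp: distributed_def distr_id2 exponential_density_def)
  from E.exponential_distributedD_gt[OF this t] b
  have "measure ?E {x \<in> space ?E. t < x} = exp (- t / b)"
    by simp
  finally show ?thesis .
qed

section \<open>Chernoff bounds for sums of independent discrete variables\<close>

text \<open>For s = -x < 0 the claim amounts to (1 - x + x^2) exp x \<ge> 1, and the Taylor lower
  bound 1 + x + x^2/2 for exp x already makes the product 1 + (x^2 + x^3 + x^4)/2. The coefficient 1
  of s^2 becomes the 4 in the exponent t^2/(4V) of the deviation bound.\<close>

lemma exp_le_quadratic:
  fixes s :: real
  assumes "\<bar>s\<bar> \<le> 1"
  shows "exp s \<le> 1 + s + s\<^sup>2"
proof (cases "0 \<le> s")
  case True
  then show ?thesis using assms exp_bound by simp
next
  case False
  define x where "x = - s"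
  have x: "0 \<le> x" using False by (simp add: x_def)
  have "0 \<le> 1 - x + x\<^sup>2" using assms x by (simp add: x_def)
  then have "(1 - x + x\<^sup>2) * (1 + x + x\<^sup>2 / 2) \<le> (1 - x + x\<^sup>2) * exp x"
    using exp_lower_Taylor_quadratic[OF x] by (intro mult_left_mono)
  moreover have "(1 - x + x\<^sup>2) * (1 + x + x\<^sup>2 / 2) = 1 + x ^ 2 / 2 + x ^ 3 / 2 + x ^ 4 / 2"
    by (simp add: field_simps power2_eq_square power3_eq_cube power4_eq_xxxx)
  moreover have "0 \<le> x ^ 2 / 2 + x ^ 3 / 2 + x ^ 4 / 2"
    using x by simp
  ultimately have "1 \<le> (1 - x + x\<^sup>2) * exp x" by linarith
  then have "exp (- x) \<le> 1 - x + x\<^sup>2"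
    by (simp add: exp_minus field_simps)
  then show ?thesis by (simp add: x_def)
qed

text \<open>Markov's inequality for the exponential of the sum, with independence turning the
  expectation into a product. Nonnegative integrals spare integrability conditions, and an arbitrary
  f lets the lower tail be treated through -f.\<close>

lemma Chernoff_PiM_pmf:
  fixes f :: "'a \<Rightarrow> real" and s a c :: real
  assumes I: "finite I" and s: "0 < s"
    and mgf: "(\<integral>\<^sup>+y. ennreal (exp (s * f y)) \<partial>measure_pmf p) \<le> ennreal (exp c)"
  shows "measure (\<Pi>\<^sub>M i\<in>I. measure_pmf p) {\<omega> \<in> space (\<Pi>\<^sub>M i\<in>I. measure_pmf p). a \<le> (\<Sum>i\<in>I. f (\<omega> i))}
           \<le> exp (card I * c - s * a)"
proof -
  let ?M = "\<Pi>\<^sub>M i\<in>I. measure_pmf p"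
  interpret product_prob_space "\<lambda>_. measure_pmf p" I by standard
  have [measurable]: "(\<lambda>\<omega>. f (\<omega> i)) \<in> borel_measurable ?M" if "i \<in> I" for i
    using that by (intro measurable_compose[OF measurable_component_singleton]) auto
  have "emeasure ?M {\<omega> \<in> space ?M. a \<le> (\<Sum>i\<in>I. f (\<omega> i))} \<le>
      ennreal (exp (- s * a)) * (\<integral>\<^sup>+\<omega>. ennreal (exp (s * (\<Sum>i\<in>I. f (\<omega> i)))) * indicator (space ?M) \<omega> \<partial>?M)"
    by (rule Chernoff_ineq_nn_integral_ge[OF s]) auto
  also have "(\<integral>\<^sup>+\<omega>. ennreal (exp (s * (\<Sum>i\<in>I. f (\<omega> i)))) * indicator (space ?M) \<omega> \<partial>?M)
      = (\<integral>\<^sup>+\<omega>. (\<Prod>i\<in>I. ennreal (exp (s * f (\<omega> i)))) \<partial>?M)"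
    using I by (intro nn_integral_cong) (simp add: sum_distrib_left exp_sum prod_ennreal)
  also have "\<dots> = (\<Prod>i\<in>I. \<integral>\<^sup>+y. ennreal (exp (s * f y)) \<partial>measure_pmf p)"
    by (rule product_nn_integral_prod[OF I]) simp
  also have "\<dots> \<le> (\<Prod>i\<in>I. ennreal (exp c))"
    by (intro prod_mono_ennreal) (use mgf in auto)
  also have "\<dots> = ennreal (exp (card I * c))"
    by (simp add: ennreal_power exp_of_nat_mult)
  finally have "emeasure ?M {\<omega> \<in> space ?M. a \<le> (\<Sum>i\<in>I. f (\<omega> i))} \<le> ennreal (exp (- s * a)) * ennreal (exp (card I * c))"
    by (simp add: mult_left_mono)
  also have "\<dots> = ennreal (exp (card I * c - s * a))"
    by (simp add: ennreal_mult[symmetric] exp_add[symmetric])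
  finally show ?thesis
    by (simp add: emeasure_eq_measure)
qed

text \<open>The hypothesis on the moment generating function is satisfied by a Bernoulli variable with
  success probability \<open>q\<close>.\<close>

lemma two_sided_Chernoff_PiM_pmf:
  fixes f :: "'a \<Rightarrow> real" and q V t :: real
  assumes I: "finite I"
    and mgf: "\<And>s. \<bar>s\<bar> \<le> 1 \<Longrightarrow> (\<integral>\<^sup>+y. ennreal (exp (s * f y)) \<partial>measure_pmf p) \<le> ennreal (exp (q * (s + s\<^sup>2)))"
    and V: "card I * q \<le> V" "0 < t" "t \<le> 2 * V"
  shows "measure (\<Pi>\<^sub>M i\<in>I. measure_pmf p)
           {\<omega> \<in> space (\<Pi>\<^sub>M i\<in>I. measure_pmf p). t \<le> \<bar>(\<Sum>i\<in>I. f (\<omega> i)) - card I * q\<bar>}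
           \<le> 2 * exp (- t\<^sup>2 / (4 * V))"
proof -
  let ?M = "\<Pi>\<^sub>M i\<in>I. measure_pmf p"
  interpret product_prob_space "\<lambda>_. measure_pmf p" I by standard
  have [measurable]: "(\<lambda>\<omega>. f (\<omega> i)) \<in> borel_measurable ?M" if "i \<in> I" for i
    using that by (intro measurable_compose[OF measurable_component_singleton]) auto
  \<comment> \<open>This s minimises V s^2 - s t, with value -t^2/(4V). The condition t \<le> 2V
    says exactly that s \<le> 1, the range covered by the hypothesis on the moment generating
    function.\<close>
  define s where "s = t / (2 * V)"
  have Vpos: "0 < V" using V by linarith
  have s: "0 < s" "s \<le> 1" using V Vpos by (auto simp: s_def)
  have bound: "card I * q * s\<^sup>2 - s * t \<le> - t\<^sup>2 / (4 * V)"
  proof -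
    have "card I * q * s\<^sup>2 \<le> V * s\<^sup>2" using V by (intro mult_right_mono) auto
    also have "V * s\<^sup>2 - s * t = - t\<^sup>2 / (4 * V)"
      using Vpos by (simp add: s_def field_simps power2_eq_square)
    finally show ?thesis by simp
  qed
  have up: "measure ?M {\<omega> \<in> space ?M. card I * q + t \<le> (\<Sum>i\<in>I. f (\<omega> i))} \<le> exp (- t\<^sup>2 / (4 * V))"
  proof -
    have "measure ?M {\<omega> \<in> space ?M. card I * q + t \<le> (\<Sum>i\<in>I. f (\<omega> i))}
        \<le> exp (card I * (q * (s + s\<^sup>2)) - s * (card I * q + t))"
      using s mgf[of s] by (intro Chernoff_PiM_pmf I) auto
    also have "\<dots> \<le> exp (- t\<^sup>2 / (4 * V))"
      using bound by (simp add: algebra_simps)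
    finally show ?thesis .
  qed
  \<comment> \<open>The lower tail is the upper tail of -f, whose moment generating function at s is
    that of f at -s.\<close>
  have down: "measure ?M {\<omega> \<in> space ?M. - (card I * q) + t \<le> (\<Sum>i\<in>I. - f (\<omega> i))} \<le> exp (- t\<^sup>2 / (4 * V))"
  proof -
    have "measure ?M {\<omega> \<in> space ?M. - (card I * q) + t \<le> (\<Sum>i\<in>I. - f (\<omega> i))}
        \<le> exp (card I * (q * (- s + s\<^sup>2)) - s * (- (card I * q) + t))"
      using s mgf[of "- s"] by (intro Chernoff_PiM_pmf I) auto
    also have "\<dots> \<le> exp (- t\<^sup>2 / (4 * V))"
      using bound by (simp add: algebra_simps)
    finally show ?thesis .
  qed
  have "measure ?M {\<omega> \<in> space ?M. t \<le> \<bar>(\<Sum>i\<in>I. f (\<omega> i)) - card I * q\<bar>} \<le>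
      measure ?M ({\<omega> \<in> space ?M. card I * q + t \<le> (\<Sum>i\<in>I. f (\<omega> i))} \<union>
                  {\<omega> \<in> space ?M. - (card I * q) + t \<le> (\<Sum>i\<in>I. - f (\<omega> i))})"
    by (intro finite_measure_mono) (auto simp: sum_negf)
  also have "\<dots> \<le> measure ?M {\<omega> \<in> space ?M. card I * q + t \<le> (\<Sum>i\<in>I. f (\<omega> i))} +
                  measure ?M {\<omega> \<in> space ?M. - (card I * q) + t \<le> (\<Sum>i\<in>I. - f (\<omega> i))}"
    by (intro measure_Un_le) measurable
  finally show ?thesis using up down by simp
qed

section \<open>Wins of one item in a single draw\<close>

definition draw_wins :: "nat \<Rightarrow> nat \<Rightarrow> (nat \<Rightarrow> nat \<Rightarrow> int) \<Rightarrow> real" where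
  "draw_wins n i y = (\<Sum>j\<in>{1..n} - {i}. if y i j = 1 then 1 else 0)"

text \<open>The probability that i wins one draw: each pair is drawn with probability 1/(n choose
  2), and against j item i wins with probability \<open>\<rho> i j\<close>.\<close>

definition win_prob :: "nat \<Rightarrow> (nat \<Rightarrow> nat \<Rightarrow> real) \<Rightarrow> nat \<Rightarrow> real" where
  "win_prob n \<rho> i = (\<Sum>j\<in>{1..n} - {i}. \<rho> i j) / real (n choose 2)"

lemma real_wins: "real (wins n m L \<omega> i) = (\<Sum>sl\<in>{1..m} \<times> {1..L}. draw_wins n i (fst \<omega> sl))"
proof -
  have "real (wins n m L \<omega> i) =
      (\<Sum>j\<in>{1..n} - {i}. \<Sum>sl\<in>{1..m} \<times> {1..L}. if fst \<omega> sl i j = 1 then 1 else 0)"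
    unfolding wins_def sum.cartesian_product
    by (simp add: of_nat_sum if_distrib[of real] case_prod_unfold cong: if_cong)
  also have "\<dots> = (\<Sum>sl\<in>{1..m} \<times> {1..L}. draw_wins n i (fst \<omega> sl))"
    unfolding draw_wins_def by (rule sum.swap)
  finally show ?thesis .
qed

lemma draw_wins_report:
  assumes "w \<noteq> l" "l \<in> {1..n}"
  shows "draw_wins n i (report w l) = (if i = w then 1 else 0)"
proof (cases "i = w")
  case True
  have "draw_wins n i (report w l) = (\<Sum>j\<in>{1..n} - {i}. if j = l then 1 else 0)"
    unfolding draw_wins_def report_def using assms True by (intro sum.cong) auto
  then show ?thesis using assms True by simp
next
  case False
  then show ?thesis by (auto simp: draw_wins_def report_def intro!: sum.neutral split: if_splits)
qed

lemma sum_pairs_containing: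
  fixes g :: "nat set \<Rightarrow> real"
  assumes "i \<in> {1..n}" "\<And>e. i \<notin> e \<Longrightarrow> g e = 0"
  shows "(\<Sum>e\<in>{e. e \<subseteq> {1..n} \<and> card e = 2}. g e) = (\<Sum>j\<in>{1..n} - {i}. g {i, j})"
proof -
  have fin: "finite {e. e \<subseteq> {1..n} \<and> card e = 2}"
    by (rule finite_subset[of _ "Pow {1..n}"]) auto
  have "(\<Sum>e\<in>{e. e \<subseteq> {1..n} \<and> card e = 2}. g e) = (\<Sum>e\<in>(\<lambda>j. {i, j}) ` ({1..n} - {i}). g e)"
  proof (rule sum.mono_neutral_right[OF fin])
    show "(\<lambda>j. {i, j}) ` ({1..n} - {i}) \<subseteq> {e. e \<subseteq> {1..n} \<and> card e = 2}"
      using assms(1) by auto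
    show "\<forall>e\<in>{e. e \<subseteq> {1..n} \<and> card e = 2} - (\<lambda>j. {i, j}) ` ({1..n} - {i}). g e = 0"
    proof (rule ballI, rule assms(2), rule notI)
      fix e assume e: "e \<in> {e. e \<subseteq> {1..n} \<and> card e = 2} - (\<lambda>j. {i, j}) ` ({1..n} - {i})" "i \<in> e"
      then obtain x y where "e = {x, y}" "x \<noteq> y" by (auto simp: card_2_iff)
      with e show False by auto
    qed
  qed
  also have "\<dots> = (\<Sum>j\<in>{1..n} - {i}. g {i, j})"
    by (subst sum.reindex) (auto simp: inj_on_def doubleton_eq_iff)
  finally show ?thesis .
qed

text \<open>On each possible report \<open>draw_wins\<close> is 0 or 1, so this is the moment
  generating function of a Bernoulli variable with success probability
  \<open>win_prob n \<rho> i\<close>. It is computed by conditioning on the drawn pair.\<close>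

lemma expectation_comparison_pmf:
  assumes \<rho>: "\<rho> \<in> pref_matrices n" and n: "2 \<le> n" and i: "i \<in> {1..n}"
  shows "measure_pmf.expectation (comparison_pmf n \<rho>) (\<lambda>y. exp (s * draw_wins n i y))
           = 1 + (exp s - 1) * win_prob n \<rho> i"
proof -
  define E where "E = {e. e \<subseteq> {1..n} \<and> card e = 2}"
  define h :: "(nat \<Rightarrow> nat \<Rightarrow> int) \<Rightarrow> real" where "h y = exp (s * draw_wins n i y)" for y
  \<comment> \<open>The conditional probability that i wins, given that the pair e is drawn. Only
    the entry at (Min, Max) is sampled from, so a win of the larger item has the complementary
    probability.\<close>
  define P where "P e = (if i = Min e then \<rho> (Min e) (Max e) else if i = Max e then 1 - \<rho> (Min e) (Max e) else 0)" for e
  have cardE: "card E = n choose 2" unfolding E_def by (subst n_subsets) auto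
  have choose_pos: "0 < n choose 2" using n by (simp add: zero_less_binomial)
  have finE: "finite E" "E \<noteq> {}" using cardE choose_pos by (auto intro: card_ge_0_finite)
  have inner: "measure_pmf.expectation
      (map_pmf (\<lambda>b. if b then report (Min e) (Max e) else report (Max e) (Min e))
        (bernoulli_pmf (\<rho> (Min e) (Max e)))) h = 1 + (exp s - 1) * P e" if e: "e \<in> E" for e
  proof -
    obtain x y where xy: "e = {x, y}" "x < y"
      using e by (auto simp: E_def card_2_iff) (metis insert_commute linorder_neqE_nat)
    have mm: "Min e = x" "Max e = y" using xy by auto
    have in_n: "x \<in> {1..n}" "y \<in> {1..n}" using e xy by (auto simp: E_def)
    then have \<rho>': "0 \<le> \<rho> x y" "\<rho> x y \<le> 1" using \<rho> by (auto simp: pref_matrices_def)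
    have hx: "h (report x y) = (if i = x then exp s else 1)"
      unfolding h_def using xy in_n by (subst draw_wins_report) auto
    have hy: "h (report y x) = (if i = y then exp s else 1)"
      unfolding h_def using xy in_n by (subst draw_wins_report) auto
    show ?thesis
      unfolding mm P_def using \<rho>' xy by (auto simp: hx hy algebra_simps)
  qed
  have "measure_pmf.expectation (comparison_pmf n \<rho>) h = (\<Sum>e\<in>E. (1 + (exp s - 1) * P e) / real (card E))"
    unfolding comparison_pmf_def E_def[symmetric]
    by (subst pmf_expectation_bind_pmf_of_set)
       (use finE in \<open>auto simp: inner divide_inverse mult.commute simp del: integral_map_pmf intro!: sum.cong\<close>)
  also have "\<dots> = (real (card E) + (exp s - 1) * (\<Sum>e\<in>E. P e)) / real (card E)"
    by (simp add: sum_divide_distrib[symmetric] sum.distrib sum_distrib_left)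
  also have "(\<Sum>e\<in>E. P e) = (\<Sum>j\<in>{1..n} - {i}. P {i, j})"
  proof -
    \<comment> \<open>\<open>P e\<close> already vanishes for pairs without i, as Min and Max belong
      to e. Writing the condition out makes the summand vanish for every set without i, so that the
      sum can be re-indexed by the opponent.\<close>
    have "(\<Sum>e\<in>E. P e) = (\<Sum>e\<in>E. if i \<in> e then P e else 0)"
    proof (intro sum.cong refl)
      fix e assume "e \<in> E"
      then have "finite e" "e \<noteq> {}" by (auto simp: E_def intro: card_ge_0_finite)
      then show "P e = (if i \<in> e then P e else 0)"
        using Min_in[of e] Max_in[of e] by (auto simp: P_def)
    qed
    also have "\<dots> = (\<Sum>j\<in>{1..n} - {i}. P {i, j})"
      unfolding E_def by (subst sum_pairs_containing[OF i]) auto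
    finally show ?thesis .
  qed
  also have "\<dots> = (\<Sum>j\<in>{1..n} - {i}. \<rho> i j)"
  proof (intro sum.cong refl)
    fix j assume j: "j \<in> {1..n} - {i}"
    then have *: "\<rho> j i + \<rho> i j = 1" using \<rho> i by (auto simp: pref_matrices_def)
    show "P {i, j} = \<rho> i j"
    proof (cases "i < j")
      case True
      then have "Min {i, j} = i" "Max {i, j} = j" by auto
      then show ?thesis by (simp add: P_def)
    next
      case False
      with j have "j < i" by auto
      then have "Min {i, j} = j" "Max {i, j} = i" by auto
      with \<open>j < i\<close> * show ?thesis by (simp add: P_def)
    qed
  qed
  finally show ?thesis
    using choose_pos unfolding h_def win_prob_def cardE by (simp add: field_simps)
qed

lemma finite_set_comparison_pmf:
  assumes "2 \<le> n"
  shows "finite (set_pmf (comparison_pmf n \<rho>))"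
proof -
  let ?E = "{e. e \<subseteq> {1..n} \<and> card e = 2}"
  have "finite ?E" by (rule finite_subset[of _ "Pow {1..n}"]) auto
  moreover have "{1, 2} \<in> ?E" using assms by auto
  then have "?E \<noteq> {}" by blast
  ultimately show ?thesis
    by (auto simp: comparison_pmf_def)
qed

lemma win_prob_nonneg:
  assumes "\<rho> \<in> pref_matrices n" "i \<in> {1..n}"
  shows "0 \<le> win_prob n \<rho> i"
  using assms by (auto simp: win_prob_def pref_matrices_def intro!: sum_nonneg divide_nonneg_nonneg)

lemma real_choose_two: "real (n choose 2) = real n * (real n - 1) / 2"
  by (cases n) (simp_all add: choose_two real_of_nat_div algebra_simps)

text \<open>Item i takes part in n - 1 of the n(n - 1)/2 pairs, so it appears in a draw with
  probability 2/n.\<close>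

lemma win_prob_le:
  assumes "\<rho> \<in> pref_matrices n" "i \<in> {1..n}" "2 \<le> n"
  shows "win_prob n \<rho> i \<le> 2 / real n"
proof -
  have "(\<Sum>j\<in>{1..n} - {i}. \<rho> i j) \<le> real (card ({1..n} - {i})) * 1"
    using assms by (intro sum_bounded_above) (auto simp: pref_matrices_def)
  also have "\<dots> = real n - 1" using assms by (simp add: of_nat_diff)
  finally have "win_prob n \<rho> i \<le> (real n - 1) / real (n choose 2)"
    unfolding win_prob_def by (rule divide_right_mono) simp
  also have "\<dots> = 2 / real n"
    using assms by (simp add: real_choose_two field_simps)
  finally show ?thesis .
qed

text \<open>The diagonal entry 1/2 is part of \<open>tau\<close> but of no draw. Removing it
  produces the constant -1/n, which cancels when two items are compared.\<close>

lemma win_prob_eq_tau: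
  assumes "\<rho> \<in> pref_matrices n" "i \<in> {1..n}" "2 \<le> n"
  shows "win_prob n \<rho> i = (2 * tau n \<rho> i - 1 / real n) / (real n - 1)"
proof -
  have "\<rho> i i + \<rho> i i = 1" using assms by (auto simp: pref_matrices_def)
  then have "(\<Sum>j\<in>{1..n} - {i}. \<rho> i j) = real n * tau n \<rho> i - 1 / 2"
    using assms by (simp add: tau_def sum_diff1)
  then show ?thesis
    unfolding win_prob_def real_choose_two using assms by (simp add: field_simps)
qed

lemma comparison_mgf_le:
  assumes "\<rho> \<in> pref_matrices n" "2 \<le> n" "i \<in> {1..n}" "\<bar>s\<bar> \<le> 1"
  shows "(\<integral>\<^sup>+y. ennreal (exp (s * draw_wins n i y)) \<partial>measure_pmf (comparison_pmf n \<rho>))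
           \<le> ennreal (exp (win_prob n \<rho> i * (s + s\<^sup>2)))"
proof -
  have "(\<integral>\<^sup>+y. ennreal (exp (s * draw_wins n i y)) \<partial>measure_pmf (comparison_pmf n \<rho>))
      = ennreal (1 + (exp s - 1) * win_prob n \<rho> i)"
    using assms
    by (subst nn_integral_eq_integral)
       (auto simp: expectation_comparison_pmf intro!: integrable_measure_pmf_finite finite_set_comparison_pmf)
  also have "1 + (exp s - 1) * win_prob n \<rho> i \<le> 1 + (s + s\<^sup>2) * win_prob n \<rho> i"
    using exp_le_quadratic[OF assms(4)] win_prob_nonneg[OF assms(1,3)]
    by (intro add_left_mono mult_right_mono) auto
  also have "\<dots> \<le> exp (win_prob n \<rho> i * (s + s\<^sup>2))"
    using exp_ge_add_one_self[of "win_prob n \<rho> i * (s + s\<^sup>2)"] by (simp add: mult.commute)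
  finally show ?thesis by (simp add: ennreal_leI)
qed

subsection \<open>The sample space\<close>

lemma measurable_wins [measurable]:
  "(\<lambda>\<omega>. real (wins n m L \<omega> i)) \<in> borel_measurable (ranking_space n m L \<epsilon> \<rho>)"
  unfolding real_wins
proof (rule borel_measurable_sum)
  fix sl assume sl: "sl \<in> {1..m} \<times> {1..L}"
  have "(\<lambda>y. draw_wins n i (y sl)) \<in>
      borel_measurable (\<Pi>\<^sub>M sl\<in>{1..m} \<times> {1..L}. measure_pmf (comparison_pmf n \<rho>))"
    using sl by (intro measurable_compose[OF measurable_component_singleton]) auto
  then show "(\<lambda>\<omega>. draw_wins n i (fst \<omega> sl)) \<in> borel_measurable (ranking_space n m L \<epsilon> \<rho>)"
    unfolding ranking_space_def by (rule measurable_compose[OF measurable_fst])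
qed

lemma measurable_noise:
  assumes "i \<in> {1..n}"
  shows "(\<lambda>\<omega>. snd \<omega> i) \<in> borel_measurable (ranking_space n m L \<epsilon> \<rho>)"
proof -
  have "(\<lambda>w. w i) \<in> borel_measurable (\<Pi>\<^sub>M i\<in>{1..n}. laplace (real L / \<epsilon>))"
    using measurable_component_singleton[OF assms, of "\<lambda>_. laplace (real L / \<epsilon>)"]
    by (simp only: measurable_cong_sets[OF refl sets_laplace])
  then show ?thesis
    unfolding ranking_space_def by (rule measurable_compose[OF measurable_snd])
qed

lemma measurable_noisy_wins:
  assumes "i \<in> {1..n}"
  shows "(\<lambda>\<omega>. noisy_wins n m L \<omega> i) \<in> borel_measurable (ranking_space n m L \<epsilon> \<rho>)"
  unfolding noisy_wins_def using measurable_noise[OF assms] by measurable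

text \<open>The rank of an index is a finite sum of indicators of comparisons between measurable
  scores.\<close>

lemma sets_mem_top_set:
  assumes [measurable]: "\<And>i. i \<in> {1..n} \<Longrightarrow> (\<lambda>\<omega>. x \<omega> i) \<in> borel_measurable M"
  shows "{\<omega> \<in> space M. i \<in> top_set \<pi> n k (x \<omega>)} \<in> sets M"
proof (cases "i \<in> {1..n}")
  case True
  have "real (score_rank \<pi> n (x \<omega>) i) =
      (\<Sum>j\<in>{1..n}. if x \<omega> j > x \<omega> i \<or> (x \<omega> j = x \<omega> i \<and> \<pi> j < \<pi> i) then 1 else 0)" for \<omega>
    by (simp add: score_rank_def sum.If_cases Int_def)
  moreover have "(\<lambda>\<omega>. \<Sum>j\<in>{1..n}. if x \<omega> j > x \<omega> i \<or> (x \<omega> j = x \<omega> i \<and> \<pi> j < \<pi> i) then 1 else (0::real))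
      \<in> borel_measurable M"
    using True by (intro borel_measurable_sum) measurable
  ultimately have [measurable]: "(\<lambda>\<omega>. real (score_rank \<pi> n (x \<omega>) i)) \<in> borel_measurable M"
    by simp
  have "{\<omega> \<in> space M. i \<in> top_set \<pi> n k (x \<omega>)} = {\<omega> \<in> space M. real (score_rank \<pi> n (x \<omega>) i) < real k}"
    using True by (auto simp: top_set_conv_score_rank)
  also have "\<dots> \<in> sets M" by measurable
  finally show ?thesis .
next
  case False
  then have "{\<omega> \<in> space M. i \<in> top_set \<pi> n k (x \<omega>)} = {}"
    using top_set_subset by blast
  then show ?thesis by (simp only: sets.empty_sets)
qed

text \<open>Upper bounds on error events follow by monotonicity from measurable supersets, but the
  lower bound on exact recovery passes to a complement and needs this event itself to be
  measurable.\<close>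

lemma sets_private_top_set_eq:
  assumes "S \<subseteq> {1..n}"
  shows "{\<omega> \<in> space (ranking_space n m L \<epsilon> \<rho>). private_top_set \<pi> n m L k \<omega> = S}
           \<in> sets (ranking_space n m L \<epsilon> \<rho>)"
proof -
  let ?M = "ranking_space n m L \<epsilon> \<rho>"
  have mem: "{\<omega> \<in> space ?M. i \<in> private_top_set \<pi> n m L k \<omega>} \<in> sets ?M" for i
    unfolding private_top_set_def by (rule sets_mem_top_set) (rule measurable_noisy_wins)
  have "{\<omega> \<in> space ?M. private_top_set \<pi> n m L k \<omega> = S} =
      {\<omega> \<in> space ?M. \<forall>i\<in>{1..n}. i \<in> private_top_set \<pi> n m L k \<omega> \<longleftrightarrow> i \<in> S}"
    using assms top_set_subset unfolding private_top_set_def by blast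
  also have "\<dots> \<in> sets ?M"
  proof (intro sets.sets_Collect_finite_All finite_atLeastAtMost)
    fix i
    show "{\<omega> \<in> space ?M. (i \<in> private_top_set \<pi> n m L k \<omega>) = (i \<in> S)} \<in> sets ?M"
      using mem[of i] sets.sets_Collect_neg[OF mem[of i]] by (cases "i \<in> S") simp_all
  qed
  finally show ?thesis .
qed

section \<open>Deviation events on the product space\<close>

lemma prob_space_PiM_pmf: "prob_space (\<Pi>\<^sub>M i\<in>I. measure_pmf p)"
  by (intro prob_space_PiM measure_pmf.prob_space_axioms)

lemma prob_space_PiM_laplace: "0 < b \<Longrightarrow> prob_space (\<Pi>\<^sub>M i\<in>I. laplace b)"
  by (intro prob_space_PiM prob_space_laplace)

lemma prob_space_ranking_space:
  assumes "1 \<le> L" "0 < \<epsilon>"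
  shows "prob_space (ranking_space n m L \<epsilon> \<rho>)"
  unfolding ranking_space_def
  using assms by (intro prob_space_pair prob_space_PiM_pmf prob_space_PiM_laplace) auto

lemma measure_pair_Times_space:
  assumes "prob_space N" "A \<in> sets M"
  shows "measure (M \<Otimes>\<^sub>M N) (A \<times> space N) = measure M A"
proof -
  interpret N: prob_space N by fact
  show ?thesis
    using assms(2) by (simp add: measure_def N.emeasure_pair_measure_Times N.emeasure_space_1)
qed

lemma measure_pair_space_Times:
  assumes "prob_space M" "prob_space N" "A \<in> sets N"
  shows "measure (M \<Otimes>\<^sub>M N) (space M \<times> A) = measure N A"
proof -
  interpret M: prob_space M by fact
  interpret N: prob_space N by fact
  show ?thesis
    using assms(3) by (simp add: measure_def N.emeasure_pair_measure_Times M.emeasure_space_1)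
qed

lemma wins_deviation:
  assumes \<rho>: "\<rho> \<in> pref_matrices n" and n: "2 \<le> n" and i: "i \<in> {1..n}"
    and L: "1 \<le> L" and \<epsilon>: "0 < \<epsilon>"
    and t: "0 < t" "t \<le> 2 * V" and V: "V = 2 * real (m * L) / real n"
  shows "measure (ranking_space n m L \<epsilon> \<rho>)
           {\<omega> \<in> space (ranking_space n m L \<epsilon> \<rho>). t \<le> \<bar>real (wins n m L \<omega> i) - real (m * L) * win_prob n \<rho> i\<bar>}
           \<le> 2 * exp (- t\<^sup>2 / (4 * V))"
proof -
  let ?I = "{1..m} \<times> {1..L}"
  let ?Y = "\<Pi>\<^sub>M sl\<in>?I. measure_pmf (comparison_pmf n \<rho>)"
  let ?W = "\<Pi>\<^sub>M i\<in>{1..n}. laplace (real L / \<epsilon>)"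
  interpret Y: prob_space ?Y by (rule prob_space_PiM_pmf)
  interpret W: prob_space ?W using L \<epsilon> by (intro prob_space_PiM_laplace) auto
  define D where "D = {y \<in> space ?Y. t \<le> \<bar>(\<Sum>sl\<in>?I. draw_wins n i (y sl)) - card ?I * win_prob n \<rho> i\<bar>}"
  have [measurable]: "(\<lambda>y. draw_wins n i (y sl)) \<in> borel_measurable ?Y" if "sl \<in> ?I" for sl
    using that by (intro measurable_compose[OF measurable_component_singleton]) auto
  have D: "D \<in> sets ?Y" unfolding D_def by measurable
  have "real (m * L) * win_prob n \<rho> i \<le> real (m * L) * (2 / real n)"
    by (intro mult_left_mono win_prob_le \<rho> n i) auto
  then have "card ?I * win_prob n \<rho> i \<le> V"
    by (simp add: V card_cartesian_product mult.commute)
  then have bound: "measure ?Y D \<le> 2 * exp (- t\<^sup>2 / (4 * V))"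
    unfolding D_def using t \<rho> n i by (intro two_sided_Chernoff_PiM_pmf comparison_mgf_le) auto
  have "{\<omega> \<in> space (?Y \<Otimes>\<^sub>M ?W). t \<le> \<bar>real (wins n m L \<omega> i) - real (m * L) * win_prob n \<rho> i\<bar>}
      = D \<times> space ?W"
    by (auto simp: D_def space_pair_measure real_wins)
  with bound show ?thesis
    unfolding ranking_space_def by (simp only: measure_pair_Times_space[OF W.prob_space_axioms D])
qed

lemma noise_tail:
  assumes i: "i \<in> {1..n}" and L: "1 \<le> L" and \<epsilon>: "0 < \<epsilon>" and t: "0 \<le> t"
  shows "measure (ranking_space n m L \<epsilon> \<rho>)
           {\<omega> \<in> space (ranking_space n m L \<epsilon> \<rho>). t < \<bar>snd \<omega> i\<bar>} = exp (- t * \<epsilon> / real L)"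
proof -
  let ?Y = "\<Pi>\<^sub>M sl\<in>{1..m} \<times> {1..L}. measure_pmf (comparison_pmf n \<rho>)"
  let ?b = "real L / \<epsilon>"
  let ?W = "\<Pi>\<^sub>M i\<in>{1..n}. laplace ?b"
  have b: "0 < ?b" using L \<epsilon> by simp
  interpret Y: prob_space ?Y by (rule prob_space_PiM_pmf)
  interpret W: prob_space ?W by (rule prob_space_PiM_laplace[OF b])
  define D where "D = {w \<in> space ?W. t < \<bar>w i\<bar>}"
  have comp: "(\<lambda>w. w i) \<in> measurable ?W (laplace ?b)"
    by (rule measurable_component_singleton[OF i])
  have D_eq: "D = (\<lambda>w. w i) -` {x. t < \<bar>x\<bar>} \<inter> space ?W" by (auto simp: D_def)
  have tail: "{x::real. t < \<bar>x\<bar>} \<in> sets (laplace ?b)" by simp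
  have D: "D \<in> sets ?W" unfolding D_eq by (rule measurable_sets[OF comp tail])
  have "distr ?W (laplace ?b) (\<lambda>w. w i) = laplace ?b"
    by (rule distr_PiM_component[OF prob_space_laplace[OF b] i])
  then have "measure ?W D = measure (laplace ?b) {x. t < \<bar>x\<bar>}"
    unfolding D_eq using measure_distr[OF comp tail] by simp
  then have "measure ?W D = exp (- t * \<epsilon> / real L)"
    using laplace_tail[OF b t] by simp
  moreover have "{\<omega> \<in> space (?Y \<Otimes>\<^sub>M ?W). t < \<bar>snd \<omega> i\<bar>} = space ?Y \<times> D"
    by (auto simp: D_def space_pair_measure)
  ultimately show ?thesis
    unfolding ranking_space_def
    by (simp only: measure_pair_space_Times[OF Y.prob_space_axioms W.prob_space_axioms D])
qed

text \<open>\<open>t\<close> and \<open>t'\<close> are the deviations of a win count and of a noise variable that are exceeded with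
  probability of order \<open>n\<^sup>-\<^sup>6\<close>; \<open>V\<close> bounds the variance of a win count.  The gap is at most \<open>1\<close>, which
  forces \<open>m\<close> to be at least of order \<open>n ln n\<close> and so puts \<open>t\<close> in the Gaussian range of the Chernoff bound.\<close>

lemma deviation_le_gap:
  fixes n m L :: nat and \<epsilon> \<Delta> :: real
  assumes n: "2 \<le> n" and m: "1 \<le> m" and L: "1 \<le> L" and \<epsilon>: "0 < \<epsilon>"
    and gap: "7 * separation n m \<epsilon> \<le> \<Delta>" "\<Delta> \<le> 1"
  defines "V \<equiv> 2 * real (m * L) / real n"
  defines "t \<equiv> sqrt (24 * V * ln (real n))" and "t' \<equiv> 6 * real L * ln (real n) / \<epsilon>"
  shows "0 < t" "t \<le> 2 * V" "0 \<le> t'" "2 * t + 2 * t' \<le> V * \<Delta>"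
    "exp (- t\<^sup>2 / (4 * V)) = real n powr - 6" "exp (- t' * \<epsilon> / real L) = real n powr - 6"
proof -
  define l where "l = ln (real n)"
  have l: "0 < l" using n by (simp add: l_def)
  have npos: "0 < real n" and mpos: "0 < real m" and Lpos: "1 \<le> real L" using n m L by auto
  have V: "0 < V" unfolding V_def using npos mpos Lpos by simp
  show t: "0 < t" unfolding t_def using V l by (simp add: l_def)
  show "0 \<le> t'" unfolding t'_def using l \<epsilon> by (simp add: l_def)
  \<comment> \<open>The factor 24 = 4 * 6 turns t^2/(4V) into 6 ln n. The 6 in t' does the same for
    the Laplace exponent.\<close>
  have t2: "t\<^sup>2 = 24 * V * l" unfolding t_def using V l by (simp add: l_def)
  show "exp (- t\<^sup>2 / (4 * V)) = real n powr - 6"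
    using V npos by (simp add: t2 powr_def l_def)
  show "exp (- t' * \<epsilon> / real L) = real n powr - 6"
    using \<epsilon> Lpos npos by (simp add: t'_def powr_def)
  define a where "a = sqrt (real n * l / real m)"
  define b where "b = real n * l / (real m * \<epsilon>)"
  have a: "0 < a" "a\<^sup>2 = real n * l / real m" unfolding a_def using l npos mpos by auto
  have b: "0 < b" unfolding b_def using l npos mpos \<epsilon> by simp
  have sep: "7 * a + 7 * b \<le> \<Delta>" using gap(1) by (simp add: separation_def a_def b_def l_def)
  \<comment> \<open>As b > 0, the bound 1 on the gap already limits a alone. Squared, this reads m
    \<ge> 49 n ln n.\<close>
  have "a \<le> 1 / 7" using sep gap(2) b by linarith
  then have "a\<^sup>2 \<le> (1 / 7)\<^sup>2" using a by (intro power_mono) auto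
  then have "real n * l / real m \<le> 1 / 49" unfolding a(2) by (simp add: power2_eq_square)
  then have "49 * (real n * l) \<le> real m" using mpos by (simp add: field_simps)
  moreover have "real m \<le> real m * real L" using mpos Lpos by simp
  ultimately have "49 * (real n * l) \<le> 2 * (real m * real L)" using npos l by (smt (verit) mult_pos_pos)
  then have "49 * l \<le> V" using npos l by (simp add: V_def field_simps)
  then have "6 * l \<le> V" using l by linarith
  then have "24 * l * V \<le> 4 * V * V" using V by simp
  then have "t\<^sup>2 \<le> (2 * V)\<^sup>2" using t2 by (simp add: power2_eq_square ac_simps)
  then show "t \<le> 2 * V" by (rule power2_le_imp_le) (use V in simp)
  \<comment> \<open>The constant 7 is decided here: V a^2 = 2 L ln n, so after squaring the claim is
    4 * 24 \<le> 2 * 7^2 * L. At L = 1 no smaller integer would do.\<close>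
  have "(2 * t)\<^sup>2 \<le> (V * (7 * a))\<^sup>2"
  proof -
    have "(V * (7 * a))\<^sup>2 = 49 * V * (V * a\<^sup>2)" by (simp add: power2_eq_square)
    also have "V * a\<^sup>2 = 2 * real L * l" unfolding a(2) V_def using npos mpos by simp
    also have "49 * V * (2 * real L * l) = (98 * real L) * (V * l)" by simp
    finally have eq: "(V * (7 * a))\<^sup>2 = (98 * real L) * (V * l)" .
    have "(2 * t)\<^sup>2 = 96 * (V * l)" using t2 by (simp add: power2_eq_square)
    also have "\<dots> \<le> (98 * real L) * (V * l)" using V l Lpos by (intro mult_right_mono) auto
    finally show ?thesis using eq by simp
  qed
  then have "2 * t \<le> V * (7 * a)" by (rule power2_le_imp_le) (use V a in simp)
  \<comment> \<open>The noise asks for less: 12 L ln n / \<epsilon> against 14 L ln n /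
    \<epsilon>.\<close>
  moreover have "2 * t' \<le> V * (7 * b)"
    using npos mpos \<epsilon> l Lpos unfolding t'_def V_def b_def l_def[symmetric]
    by (simp add: field_simps)
  moreover have "V * (7 * a + 7 * b) \<le> V * \<Delta>"
    using V sep by (intro mult_left_mono) auto
  ultimately show "2 * t + 2 * t' \<le> V * \<Delta>"
    by (simp add: algebra_simps)
qed

section \<open>Error probability of the private top set\<close>

lemma tau_bounds:
  assumes "\<rho> \<in> pref_matrices n" "i \<in> {1..n}"
  shows "0 \<le> tau n \<rho> i" "tau n \<rho> i \<le> 1"
proof -
  have "(\<Sum>j=1..n. \<rho> i j) \<le> real (card {1..n}) * 1"
    using assms by (intro sum_bounded_above) (auto simp: pref_matrices_def)
  then show "tau n \<rho> i \<le> 1" using assms by (simp add: tau_def field_simps)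
  show "0 \<le> tau n \<rho> i"
    using assms by (auto simp: tau_def pref_matrices_def intro!: sum_nonneg divide_nonneg_nonneg)
qed

lemma private_top_set_error:
  fixes n m L :: nat and \<epsilon> :: real
  assumes L: "1 \<le> L" and m: "1 \<le> m" and \<epsilon>: "0 < \<epsilon>" and inj: "inj_on \<pi> {1..n}"
    and k: "k \<in> {1..n - 1}" and u: "u \<in> {0..min (k - 1) (n - k - 1)}"
    and Theta: "\<rho> \<in> Theta n m \<epsilon> k u 7"
  shows "measure (ranking_space n m L \<epsilon> \<rho>)
           {\<omega> \<in> space (ranking_space n m L \<epsilon> \<rho>).
              hamming_dist (private_top_set \<pi> n m L k \<omega>) (top_set \<pi> n k (tau n \<rho>)) > 2 * u}
           \<le> 3 * real n powr (- 5)"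
proof -
  let ?M = "ranking_space n m L \<epsilon> \<rho>"
  let ?x = "tau n \<rho>"
  \<comment> \<open>The range of u keeps the ranks k - u and k + u + 1 within {1..n}, where
    \<open>ordered_value\<close> is meaningful and natural subtraction does not truncate.\<close>
  have n: "2 \<le> n" and ku: "1 \<le> k - u" "k - u \<le> n" "u \<le> k" "k + u < n" using k u by auto
  have \<rho>: "\<rho> \<in> pref_matrices n" using Theta by (simp add: Theta_def)
  interpret prob_space ?M by (rule prob_space_ranking_space[OF L \<epsilon>])
  define \<Delta> where "\<Delta> = ordered_value n ?x (k - u) - ordered_value n ?x (k + u + 1)"
  have "ordered_value n ?x (k - u) \<in> ?x ` {1..n}" "ordered_value n ?x (k + u + 1) \<in> ?x ` {1..n}"
    by (rule ordered_value_in_image; use ku in simp)+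
  then have gap: "7 * separation n m \<epsilon> \<le> \<Delta>" "\<Delta> \<le> 1"
    using Theta tau_bounds[OF \<rho>] by (auto simp: \<Delta>_def Theta_def) (smt (verit) atLeastAtMost_iff)
  define V where "V = 2 * real (m * L) / real n"
  define t where "t = sqrt (24 * V * ln (real n))"
  define t' where "t' = 6 * real L * ln (real n) / \<epsilon>"
  note dev = deviation_le_gap[OF n m L \<epsilon> gap, folded V_def, folded t_def t'_def]
  define \<mu> where "\<mu> i = real (m * L) * win_prob n \<rho> i" for i
  define B where "B i = {\<omega> \<in> space ?M. t \<le> \<bar>real (wins n m L \<omega> i) - \<mu> i\<bar>}" for i
  define B' where "B' i = {\<omega> \<in> space ?M. t' < \<bar>snd \<omega> i\<bar>}" for i
  have B: "B i \<in> events" "prob (B i) \<le> 2 * real n powr - 6" if "i \<in> {1..n}" for i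
    using wins_deviation[OF \<rho> n that L \<epsilon> dev(1,2) V_def] dev(5)
    unfolding B_def \<mu>_def by (measurable, simp)
  have B': "B' i \<in> events" "prob (B' i) = real n powr - 6" if "i \<in> {1..n}" for i
    using measurable_noise[OF that] noise_tail[OF that L \<epsilon> dev(3)] dev(6)
    unfolding B'_def by (measurable, simp)
  have sub: "{\<omega> \<in> space ?M. hamming_dist (private_top_set \<pi> n m L k \<omega>) (top_set \<pi> n k ?x) > 2 * u}
      \<subseteq> (\<Union>i\<in>{1..n}. B i \<union> B' i)"
  proof (rule ccontr)
    assume "\<not> ?thesis"
    then obtain \<omega> where \<omega>: "\<omega> \<in> space ?M"
        "hamming_dist (private_top_set \<pi> n m L k \<omega>) (top_set \<pi> n k ?x) > 2 * u"
        "\<And>i. i \<in> {1..n} \<Longrightarrow> \<omega> \<notin> B i" "\<And>i. i \<in> {1..n} \<Longrightarrow> \<omega> \<notin> B' i"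
      by blast
    have close: "\<bar>noisy_wins n m L \<omega> i - \<mu> i\<bar> < t + t'" if "i \<in> {1..n}" for i
      using \<omega>(3,4)[OF that] \<omega>(1) by (auto simp: noisy_wins_def B_def B'_def)
    have "hamming_dist (private_top_set \<pi> n m L k \<omega>) (top_set \<pi> n k ?x) \<le> 2 * u"
      unfolding private_top_set_def
    proof (rule hamming_dist_top_set_le[OF inj])
      show "u \<le> k" "k + u \<le> n" using ku by auto
      fix h l assume h: "h \<in> top_set \<pi> n (k - u) ?x" and l: "l \<in> {1..n} - top_set \<pi> n (k + u) ?x"
      have hn: "h \<in> {1..n}" and ln: "l \<in> {1..n}" using h l top_set_subset by blast+
      have "ordered_value n ?x (k - u) \<le> ?x h"
        by (rule top_set_ge_ordered_value[OF h ku(1,2)])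
      moreover have "?x l \<le> ordered_value n ?x (k + u + 1)"
        using not_top_set_le_ordered_value[OF l ku(4)] by simp
      ultimately have \<Delta>: "\<Delta> \<le> ?x h - ?x l" by (simp add: \<Delta>_def)
      \<comment> \<open>The sign is needed below, where the denominator n coming from V is replaced
        by the n - 1 in the slope of \<open>win_prob\<close>: this enlarges the fraction only for a
        nonnegative gap.\<close>
      have "0 \<le> \<Delta>"
      proof -
        have "0 \<le> 2 * t + 2 * t'" using dev(1,3) by simp
        also note dev(4)
        finally have "0 \<le> V * \<Delta>" .
        moreover have "0 < V" using dev(1,2) by linarith
        ultimately show ?thesis by (simp add: zero_le_mult_iff)
      qed
      have "2 * t + 2 * t' \<le> V * \<Delta>" by (rule dev(4))
      also have "V * \<Delta> = real (m * L) * (2 * \<Delta> / real n)" by (simp add: V_def)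
      also have "2 * \<Delta> / real n \<le> 2 * (?x h - ?x l) / (real n - 1)"
        using \<Delta> \<open>0 \<le> \<Delta>\<close> n by (intro frac_le) auto
      also have "\<dots> = win_prob n \<rho> h - win_prob n \<rho> l"
        unfolding win_prob_eq_tau[OF \<rho> hn n] win_prob_eq_tau[OF \<rho> ln n]
        by (simp add: diff_divide_distrib[symmetric] right_diff_distrib)
      finally have "2 * t + 2 * t' \<le> \<mu> h - \<mu> l"
        by (simp add: \<mu>_def right_diff_distrib mult_left_mono)
      with close[OF hn] close[OF ln] show "noisy_wins n m L \<omega> l < noisy_wins n m L \<omega> h"
        by linarith
    qed
    with \<omega>(2) show False by simp
  qed
  have "prob {\<omega> \<in> space ?M. hamming_dist (private_top_set \<pi> n m L k \<omega>) (top_set \<pi> n k ?x) > 2 * u}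
      \<le> prob (\<Union>i\<in>{1..n}. B i \<union> B' i)"
    using B(1) B'(1) by (intro finite_measure_mono[OF sub]) auto
  also have "\<dots> \<le> (\<Sum>i\<in>{1..n}. prob (B i \<union> B' i))"
    using B(1) B'(1) by (intro finite_measure_subadditive_finite) auto
  \<comment> \<open>The 3 consists of 2 for the two tails of the count and 1 for the noise.\<close>
  also have "\<dots> \<le> (\<Sum>i\<in>{1..n}. 3 * real n powr - 6)"
  proof (rule sum_mono)
    fix i assume i: "i \<in> {1..n}"
    have "prob (B i \<union> B' i) \<le> prob (B i) + prob (B' i)"
      by (rule measure_Un_le[OF B(1)[OF i] B'(1)[OF i]])
    then show "prob (B i \<union> B' i) \<le> 3 * real n powr - 6"
      using B(2)[OF i] B'(2)[OF i] by simp
  qed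
  also have "\<dots> = 3 * (real n powr 1 * real n powr - 6)" using n by simp
  also have "\<dots> = 3 * real n powr - 5" using powr_add[of "real n" 1 "- 6"] n by simp
  finally show ?thesis .
qed

theorem theorem3p3:
  fixes L :: nat
  assumes "L \<ge> 1"
  shows "\<exists>C>0. \<exists>K::real. \<forall>(n::nat) (m::nat) (\<epsilon>::real) (\<pi>::nat \<Rightarrow> nat).
           m \<ge> 1 \<longrightarrow> \<epsilon> > 0 \<longrightarrow> inj_on \<pi> {1..n} \<longrightarrow>
           (\<forall>k\<in>{1..n - 1}.
              (\<forall>u\<in>{0..min (k - 1) (n - k - 1)}. \<forall>\<rho>\<in>Theta n m \<epsilon> k u C.
                 measure (ranking_space n m L \<epsilon> \<rho>)
                   {\<omega> \<in> space (ranking_space n m L \<epsilon> \<rho>).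
                      hamming_dist (private_top_set \<pi> n m L k \<omega>) (top_set \<pi> n k (tau n \<rho>)) > 2 * u}
                 \<le> K * real n powr (- 5)) \<and>
              (\<forall>\<rho>\<in>pref_matrices n.
                 ordered_value n (tau n \<rho>) k - ordered_value n (tau n \<rho>) (k + 1)
                   \<ge> C * (sqrt (real n * ln (real n) / real m) + real n * ln (real n) / (real m * \<epsilon>)) \<longrightarrow>
                 measure (ranking_space n m L \<epsilon> \<rho>)
                   {\<omega> \<in> space (ranking_space n m L \<epsilon> \<rho>).
                      private_top_set \<pi> n m L k \<omega> = top_set \<pi> n k (tau n \<rho>)}
                 \<ge> 1 - K * real n powr (- 5)))"
proof (rule exI[of _ 7], intro conjI exI[of _ 3] allI impI ballI)
  fix n m k :: nat and \<epsilon> :: real and \<pi> :: "nat \<Rightarrow> nat" and \<rho>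
  assume *: "m \<ge> 1" "\<epsilon> > 0" "inj_on \<pi> {1..n}" "k \<in> {1..n - 1}"
  {
    fix u assume "u \<in> {0..min (k - 1) (n - k - 1)}" "\<rho> \<in> Theta n m \<epsilon> k u 7"
    then show "measure (ranking_space n m L \<epsilon> \<rho>)
        {\<omega> \<in> space (ranking_space n m L \<epsilon> \<rho>).
           hamming_dist (private_top_set \<pi> n m L k \<omega>) (top_set \<pi> n k (tau n \<rho>)) > 2 * u}
        \<le> 3 * real n powr (- 5)"
      by (rule private_top_set_error[OF assms *])
  }
  let ?M = "ranking_space n m L \<epsilon> \<rho>"
  let ?S = "top_set \<pi> n k (tau n \<rho>)"
  let ?E = "{\<omega> \<in> space ?M. private_top_set \<pi> n m L k \<omega> = ?S}"
  assume "\<rho> \<in> pref_matrices n" "ordered_value n (tau n \<rho>) k - ordered_value n (tau n \<rho>) (k + 1)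
      \<ge> 7 * (sqrt (real n * ln (real n) / real m) + real n * ln (real n) / (real m * \<epsilon>))"
  then have "\<rho> \<in> Theta n m \<epsilon> k 0 7" by (simp add: Theta_def separation_def)
  then have err: "measure ?M {\<omega> \<in> space ?M. hamming_dist (private_top_set \<pi> n m L k \<omega>) ?S > 2 * 0}
      \<le> 3 * real n powr (- 5)"
    by (intro private_top_set_error[OF assms *]) auto
  interpret prob_space ?M by (rule prob_space_ranking_space[OF assms *(2)])
  have "hamming_dist (private_top_set \<pi> n m L k \<omega>) ?S = 0 \<longleftrightarrow> private_top_set \<pi> n m L k \<omega> = ?S" for \<omega>
    unfolding private_top_set_def by (rule hamming_dist_eq_0_iff) simp_all
  \<comment> \<open>Failure of exact recovery is a positive Hamming distance, so the error bound for
    u = 0 speaks of the complement of the recovery event.\<close>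
  then have "space ?M - ?E = {\<omega> \<in> space ?M. hamming_dist (private_top_set \<pi> n m L k \<omega>) ?S > 2 * 0}"
    by (auto simp flip: neq0_conv)
  with err have "prob (space ?M - ?E) \<le> 3 * real n powr (- 5)" by simp
  moreover have "?E \<in> events" by (rule sets_private_top_set_eq[OF top_set_subset])
  ultimately show "prob ?E \<ge> 1 - 3 * real n powr (- 5)"
    using prob_compl[of ?E] by simp
qed simp

end
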